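(* Let $f:\mathbb{R}\to\mathbb{R}$ be a smooth convex function with a unique extreme point (minimizer) $t^*$, and let $p>0$. Suppose $f$ satisfies $p$-order Lipschitz continuous gradient: there is $\mu>0$ with $|f^{(1)}(x)-f^{(1)}(y)|\le\mu|x-y|^p$ for all $x,y\in\mathbb{R}$. Let $0<\alpha<2$ with $p<\alpha<1+p$. Then, for arbitrary $\rho>0$, the fractional order gradient method $$t_{k+2}=t_{k+1}-\rho f^{(1)}(t_{k+1})\,|t_{k+1}-t_k|^{1-\alpha},\qquad k\ge1,$$ always converges to a bounded region of $t^*$, and moreover the upper bound of this region is $(\rho\mu)^{\frac{1}{\alpha-p}}$: every sequence $(t_k)_{k\ge1}$ generated by the method satisfies $\limsup_{k\to\infty}|t_k-t^*|\le(\rho\mu)^{\frac{1}{\alpha-p}}$.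
   Context: $f^{(1)}$ denotes the first derivative of $f$. A sequence generated by the method is an infinite real sequence $(t_k)_{k\ge 1}$, started from real initial points $t_1\neq t_2$, satisfying the recursion for all $k\ge1$. When $\alpha>1$ the exponent $1-\alpha$ is negative and the recursion only makes sense while $t_{k+1}\ne t_k$; in that case it is assumed that $t_{k+1}\neq t_k$ for all $k$. The standing range of the gradient order for the method is $0<\alpha<2$. *)

theory Defs
  imports "HOL-Analysis.Analysis"
begin

(* In the library 0 powr 0 = 0; here the usual convention 0 ^ 0 = 1 is restored, so that the
   order \<alpha> = 1 gives ordinary gradient descent. *)
definition rpow :: "real \<Rightarrow> real \<Rightarrow> real" where
  "rpow x a = (if a = 0 then 1 else x powr a)"

(* Sequences are indexed from 1; the value t 0 is irrelevant. For \<alpha> > 1 the exponent is negative,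
   and the last conjunct keeps the method from evaluating it at base 0. *)
definition frac_grad_seq :: "(real \<Rightarrow> real) \<Rightarrow> real \<Rightarrow> real \<Rightarrow> (nat \<Rightarrow> real) \<Rightarrow> bool" where
  "frac_grad_seq f \<alpha> \<rho> t \<longleftrightarrow>
     t 1 \<noteq> t 2 \<and>
     (\<forall>k\<ge>1. t (k + 2) =
        t (k + 1) - \<rho> * deriv f (t (k + 1)) * rpow \<bar>t (k + 1) - t k\<bar> (1 - \<alpha>)) \<and>
     (\<alpha> > 1 \<longrightarrow> (\<forall>k\<ge>1. t (k + 1) \<noteq> t k))"

definition unique_minimizer :: "(real \<Rightarrow> real) \<Rightarrow> real \<Rightarrow> bool" where
  "unique_minimizer f s \<longleftrightarrow> (\<forall>x. (\<forall>y. f x \<le> f y) \<longleftrightarrow> x = s)"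

definition lipschitz_gradient :: "real \<Rightarrow> real \<Rightarrow> (real \<Rightarrow> real) \<Rightarrow> bool" where
  "lipschitz_gradient p \<mu> f \<longleftrightarrow>
     (\<forall>x y. \<bar>deriv f x - deriv f y\<bar> \<le> \<mu> * \<bar>x - y\<bar> powr p)"

end

theory Submission
  imports Defs
begin

text \<open>Shift the minimizer to 0 and let \<open>d n\<close> be the length of the n-th step. An iteration step either
  keeps its side of the minimizer and moves closer to it, or it crosses the minimizer and lands within
  distance \<open>d n\<close>. In the latter case the Lipschitz condition bounds the next step by
  \<open>\<phi> (d n)\<close>, where \<open>\<phi> y = \<rho> \<mu> y powr (p + 1 - \<alpha>)\<close> has the fixed point \<open>R = (\<rho> \<mu>) powr (1 / (\<alpha> - p))\<close>
  and satisfies \<open>\<phi> y < y\<close> beyond it.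

  If there are finitely many crossings, the distances decrease to a limit and the steps tend to 0, which
  forces the gradient to vanish in the limit. If there are infinitely many, a quantity \<open>S n \<ge> max R (d n)\<close>
  is nonincreasing and contracts towards R at every crossing; one takes
  \<open>S n = max R (max \<bar>x (n + 1)\<bar> (d n))\<close> for \<open>\<alpha> \<le> 1\<close> and \<open>S n = max R (max (d n) (d (n + 1)))\<close> for \<open>\<alpha> > 1\<close>.
  So the landing points of crossings are eventually within any \<open>B > R\<close>, hence so are all iterates.\<close>

section \<open>Two auxiliary facts: contraction at infinitely many indices, and weighted
  means\<close>

lemma decseq_tendsto_lower_bound:
  fixes S :: "nat \<Rightarrow> real" and h :: "real \<Rightarrow> real"
  assumes dec: "decseq S" and low: "\<And>n. R \<le> S n"
    and freq: "\<exists>\<^sub>F n in sequentially. S (Suc n) \<le> max R (h (S n))"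
    and cont: "\<And>y. y > R \<Longrightarrow> isCont h y" and less: "\<And>y. y > R \<Longrightarrow> h y < y"
  shows "S \<longlonglongrightarrow> R"
proof -
  obtain L where L: "S \<longlonglongrightarrow> L" "\<And>n. L \<le> S n"
    using decseq_convergent[OF dec, of R] low by blast
  have "R \<le> L"
    using L(1) low by (intro LIMSEQ_le_const) auto
  \<comment> \<open>If L > R, continuity and h L < L put \<open>max R (h (S n))\<close> eventually
    below L. At one of the infinitely many contracting indices the next value then falls below the
    limit of a nonincreasing sequence.\<close>
  moreover have "\<not> R < L"
  proof
    assume "R < L"
    have "(\<lambda>n. max R (h (S n))) \<longlonglongrightarrow> max R (h L)"
      using isCont_tendsto_compose[OF cont[OF \<open>R < L\<close>] L(1)] by (intro tendsto_intros)
    moreover have "max R (h L) < L"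
      using less[OF \<open>R < L\<close>] \<open>R < L\<close> by simp
    ultimately have "\<forall>\<^sub>F n in sequentially. max R (h (S n)) < L"
      by (rule order_tendstoD)
    with freq have "\<exists>\<^sub>F n in sequentially. S (Suc n) \<le> max R (h (S n)) \<and> max R (h (S n)) < L"
      by (rule frequently_eventually_frequently)
    then obtain n where "S (Suc n) < L"
      by (metis (no_types, lifting) frequently_ex le_less_trans)
    with L(2)[of "Suc n"] show False by simp
  qed
  ultimately show ?thesis using L(1) by simp
qed

lemma weighted_geometric_mean_le_max:
  fixes a b w :: real
  assumes "0 \<le> a" "0 \<le> b" "0 \<le> w" "w \<le> 1"
  shows "a powr w * b powr (1 - w) \<le> max a b"
proof -
  have "a powr w * b powr (1 - w) \<le> max a b powr w * max a b powr (1 - w)"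
    using assms by (intro mult_mono powr_mono2) auto
  also have "\<dots> = max a b powr 1"
    by (subst powr_add[symmetric]) simp
  finally show ?thesis using assms by simp
qed

text \<open>This covers the runs without a step of length zero, so every base of \<open>powr\<close>
  in the recursion is positive.\<close>

locale fractional_descent =
  fixes g :: "real \<Rightarrow> real" and x :: "nat \<Rightarrow> real" and p \<mu> \<alpha> \<rho> :: real
  assumes g_mono: "mono g"
    and g_zero_iff: "\<And>z. g z = 0 \<longleftrightarrow> z = 0"
    and g_bound: "\<And>z. \<bar>g z\<bar> \<le> \<mu> * \<bar>z\<bar> powr p"
    and p_pos: "0 < p" and \<mu>_pos: "0 < \<mu>" and \<rho>_pos: "0 < \<rho>"
    and \<alpha>_pos: "0 < \<alpha>" and \<alpha>_less: "\<alpha> < 2" and p_less: "p < \<alpha>" and \<alpha>_less_p: "\<alpha> < 1 + p"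
    and step: "\<And>n. x (Suc (Suc n)) =
          x (Suc n) - \<rho> * g (x (Suc n)) * \<bar>x (Suc n) - x n\<bar> powr (1 - \<alpha>)"
    and moves: "\<And>n. x (Suc n) \<noteq> x n"
begin

section \<open>Step lengths, crossings and one-step estimates\<close>

definition d :: "nat \<Rightarrow> real" where "d n = \<bar>x (Suc n) - x n\<bar>"
definition R :: real where "R = (\<rho> * \<mu>) powr (1 / (\<alpha> - p))"
definition \<phi> :: "real \<Rightarrow> real" where "\<phi> y = \<rho> * \<mu> * y powr (p + 1 - \<alpha>)"

text \<open>A zero endpoint counts as a crossing, so a step that does not cross has nonzero
  endpoints of equal sign.\<close>

definition crossing :: "nat \<Rightarrow> bool" where "crossing n \<longleftrightarrow> x n * x (Suc n) \<le> 0"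

lemma d_pos: "0 < d n"
  using moves by (simp add: d_def)

lemma R_pos: "0 < R"
  using \<rho>_pos \<mu>_pos by (simp add: R_def)

lemma R_powr: "\<rho> * \<mu> = R powr (\<alpha> - p)"
  using \<rho>_pos \<mu>_pos p_less by (simp add: R_def powr_powr)

lemma \<phi>_mono: "0 \<le> y \<Longrightarrow> y \<le> z \<Longrightarrow> \<phi> y \<le> \<phi> z"
  unfolding \<phi>_def using \<rho>_pos \<mu>_pos \<alpha>_less_p
  by (intro mult_left_mono powr_mono2) auto

lemma \<phi>_nonneg: "0 \<le> \<phi> y"
  using \<rho>_pos \<mu>_pos by (simp add: \<phi>_def)

lemma \<phi>_R: "\<phi> R = R"
  using R_pos by (simp add: \<phi>_def R_powr powr_add[symmetric])

text \<open>For y > 0, \<phi> y = y * (R / y) powr (\<alpha> - p), and the exponent is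
  positive.\<close>

lemma \<phi>_less:
  assumes "R < y"
  shows "\<phi> y < y"
proof -
  have "0 < y" using assms R_pos by simp
  have "\<rho> * \<mu> < y powr (\<alpha> - p)"
    unfolding R_powr using assms R_pos p_less by (intro powr_less_mono2) auto
  hence "\<phi> y < y powr (\<alpha> - p) * y powr (p + 1 - \<alpha>)"
    unfolding \<phi>_def using \<open>0 < y\<close> by (intro mult_strict_right_mono) auto
  also have "\<dots> = y" using \<open>0 < y\<close> by (simp add: powr_add[symmetric])
  finally show ?thesis .
qed

lemma \<phi>_le_max: "0 \<le> y \<Longrightarrow> \<phi> y \<le> max R y"
  using \<phi>_less[of y] \<phi>_mono[of y R] \<phi>_R by (cases "R < y") auto

lemma isCont_\<phi>: "R < y \<Longrightarrow> isCont \<phi> y"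
  unfolding \<phi>_def[abs_def] using R_pos by (intro continuous_intros) auto

lemma d_Suc: "d (Suc n) = \<rho> * \<bar>g (x (Suc n))\<bar> * d n powr (1 - \<alpha>)"
  using \<rho>_pos by (simp add: d_def step[of n] abs_mult)

lemma d_Suc_le: "d (Suc n) \<le> \<rho> * \<mu> * \<bar>x (Suc n)\<bar> powr p * d n powr (1 - \<alpha>)"
proof -
  have "\<rho> * \<bar>g (x (Suc n))\<bar> \<le> \<rho> * (\<mu> * \<bar>x (Suc n)\<bar> powr p)"
    using \<rho>_pos g_bound by (intro mult_left_mono) auto
  thus ?thesis
    unfolding d_Suc by (intro mult_right_mono) (auto simp: mult.assoc)
qed

text \<open>The origin lies between the endpoints of a crossing step, so \<open>d n\<close> is the
  sum of their distances to it.\<close>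

lemma crossing_le: "crossing n \<Longrightarrow> \<bar>x (Suc n)\<bar> \<le> d n"
  unfolding crossing_def d_def by (auto simp: mult_le_0_iff)

text \<open>Only the factor with exponent p is enlarged, from the landing distance to
  \<open>d n\<close>; the factor with exponent 1 - \<alpha> stays, so the argument covers both signs
  of 1 - \<alpha>.\<close>

lemma d_Suc_le_\<phi>:
  assumes "crossing n"
  shows "d (Suc n) \<le> \<phi> (d n)"
proof -
  have "d (Suc n) \<le> \<rho> * \<mu> * \<bar>x (Suc n)\<bar> powr p * d n powr (1 - \<alpha>)"
    by (rule d_Suc_le)
  also have "\<dots> \<le> \<rho> * \<mu> * d n powr p * d n powr (1 - \<alpha>)"
    using crossing_le[OF assms] \<rho>_pos \<mu>_pos p_pos
    by (intro mult_left_mono mult_right_mono powr_mono2) auto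
  also have "\<dots> = \<phi> (d n)"
    by (simp add: \<phi>_def mult.assoc powr_add[symmetric] add_diff_eq)
  finally show ?thesis .
qed

lemma g_sgn: "sgn (g z) = sgn z"
  using monoD[OF g_mono, of 0 z] monoD[OF g_mono, of z 0] g_zero_iff[of z] g_zero_iff[of 0]
  by (cases z "0 :: real" rule: linorder_cases) (auto simp: sgn_if)

text \<open>The displacement is a negative multiple of the gradient and so points towards the
  origin; staying on the same side, the iterate gets closer, and monotonicity of \<open>g\<close>
  shrinks the gradient. The index is \<open>Suc n\<close> because the very first step is
  arbitrary.\<close>

lemma not_crossing:
  assumes "\<not> crossing (Suc n)"
  shows "\<bar>x (Suc (Suc n))\<bar> = \<bar>x (Suc n)\<bar> - d (Suc n)"
    and "\<bar>g (x (Suc (Suc n)))\<bar> \<le> \<bar>g (x (Suc n))\<bar>"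
proof -
  define e where "e = \<rho> * \<bar>x (Suc n) - x n\<bar> powr (1 - \<alpha>)"
  have e: "0 < e" using \<rho>_pos moves[of n] by (simp add: e_def)
  have s: "x (Suc (Suc n)) = x (Suc n) - e * g (x (Suc n))"
    by (simp add: step[of n] e_def)
  have d: "d (Suc n) = e * \<bar>g (x (Suc n))\<bar>"
    using e by (simp add: d_def s abs_mult)
  from assms consider "0 < x (Suc n)" "0 < x (Suc (Suc n))" | "x (Suc n) < 0" "x (Suc (Suc n)) < 0"
    by (auto simp: crossing_def not_le zero_less_mult_iff)
  hence "\<bar>x (Suc (Suc n))\<bar> = \<bar>x (Suc n)\<bar> - d (Suc n) \<and> \<bar>g (x (Suc (Suc n)))\<bar> \<le> \<bar>g (x (Suc n))\<bar>"
  proof cases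
    case 1
    hence pos: "0 < g (x (Suc n))" "0 < g (x (Suc (Suc n)))"
      using g_sgn by (metis sgn_1_pos)+
    moreover have "x (Suc (Suc n)) \<le> x (Suc n)"
      unfolding s using e pos by simp
    ultimately show ?thesis
      using 1 monoD[OF g_mono] by (auto simp: d s)
  next
    case 2
    hence neg: "g (x (Suc n)) < 0" "g (x (Suc (Suc n))) < 0"
      using g_sgn by (metis sgn_1_neg)+
    moreover have "x (Suc n) \<le> x (Suc (Suc n))"
      unfolding s using e neg by (simp add: mult_nonneg_nonpos)
    ultimately show ?thesis
      using 2 monoD[OF g_mono] by (auto simp: d s)
  qed
  thus "\<bar>x (Suc (Suc n))\<bar> = \<bar>x (Suc n)\<bar> - d (Suc n)" 
    and "\<bar>g (x (Suc (Suc n)))\<bar> \<le> \<bar>g (x (Suc n))\<bar>" by auto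
qed

lemma g_bounded_below:
  assumes "0 < L"
  obtains m where "0 < m" "\<And>z. L \<le> \<bar>z\<bar> \<Longrightarrow> m \<le> \<bar>g z\<bar>"
proof
  show "0 < min (g L) (- g (- L))"
    using assms g_sgn[of L] g_sgn[of "- L"] by (auto simp: sgn_if split: if_splits)
  show "min (g L) (- g (- L)) \<le> \<bar>g z\<bar>" if "L \<le> \<bar>z\<bar>" for z
    using that monoD[OF g_mono, of L z] monoD[OF g_mono, of z "- L"] by (auto simp: abs_if split: if_splits)
qed

section \<open>Finitely many crossings: convergence to the minimizer\<close>

lemma tendsto_zero_if_finitely_many_crossings:
  assumes "\<forall>\<^sub>F n in sequentially. \<not> crossing n"
  shows "(\<lambda>n. \<bar>x n\<bar>) \<longlonglongrightarrow> 0"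
proof -
  obtain N where N: "\<And>n. N \<le> n \<Longrightarrow> \<not> crossing n"
    using assms by (auto simp: eventually_sequentially)
  define y where "y n = \<bar>x (Suc (n + N))\<bar>" for n
  have y_Suc: "y (Suc n) = y n - d (Suc (n + N))" for n
    unfolding y_def using not_crossing(1)[of "n + N"] N[of "Suc (n + N)"] by simp
  have "decseq y"
    unfolding decseq_Suc_iff y_Suc using d_pos by (simp add: less_imp_le)
  then obtain L where L: "y \<longlonglongrightarrow> L" "\<And>n. L \<le> y n"
    using decseq_convergent[of y 0] by (auto simp: y_def)
  have "0 \<le> L" using L(1) by (intro LIMSEQ_le_const) (auto simp: y_def)
  have "(\<lambda>n. y n - y (Suc n)) \<longlonglongrightarrow> L - L"
    by (intro tendsto_diff L(1) LIMSEQ_Suc)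
  hence d0: "(\<lambda>n. d (Suc (n + N))) \<longlonglongrightarrow> 0"
    by (simp add: y_Suc)
  \<comment> \<open>If L > 0, the gradient stays at least m in absolute value, so each step is at
    least \<rho> * m / \<open>e n powr \<alpha>\<close> times the previous one. Once the steps are
    small this factor exceeds 1, and they cannot tend to 0.\<close>
  have "\<not> 0 < L"
  proof
    assume "0 < L"
    then obtain m where m: "0 < m" "\<And>z. L \<le> \<bar>z\<bar> \<Longrightarrow> m \<le> \<bar>g z\<bar>"
      using g_bounded_below by blast
    define e where "e n = d (Suc (n + N))" for n
    have e_pos: "0 < e n" for n by (simp add: e_def d_pos)
    have e0: "e \<longlonglongrightarrow> 0" using d0 by (simp add: e_def[abs_def])
    have e_Suc: "\<rho> * m * e n powr (1 - \<alpha>) \<le> e (Suc n)" for n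
      unfolding e_def add_Suc d_Suc[of "Suc (n + N)"]
      using m(2) L(2)[of "Suc n"] \<rho>_pos
      by (intro mult_right_mono mult_left_mono) (auto simp: y_def)
    have "(\<lambda>n. e n powr \<alpha>) \<longlonglongrightarrow> 0 powr \<alpha>"
      using \<alpha>_pos e_pos by (intro tendsto_powr' e0 tendsto_const) (auto simp: less_imp_le)
    hence "\<forall>\<^sub>F n in sequentially. e n powr \<alpha> < \<rho> * m"
      using m(1) \<rho>_pos by (intro order_tendstoD(2)[of _ 0]) auto
    then obtain K where K: "\<And>n. K \<le> n \<Longrightarrow> e n powr \<alpha> < \<rho> * m"
      by (auto simp: eventually_sequentially)
    have e_le: "e n \<le> e (Suc n)" if "K \<le> n" for n
    proof -
      have "e n = e n powr \<alpha> * e n powr (1 - \<alpha>)"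
        using e_pos[of n] by (simp add: powr_add[symmetric])
      also have "\<dots> \<le> \<rho> * m * e n powr (1 - \<alpha>)"
        using K[OF that] by (intro mult_right_mono) auto
      finally show ?thesis using e_Suc[of n] by simp
    qed
    have "e K \<le> e n" if "K \<le> n" for n
      using that
    proof (induction n rule: dec_induct)
      case (step n)
      thus ?case using e_le[of n] by simp
    qed simp
    hence "e K \<le> 0"
      using e0 by (intro LIMSEQ_le_const) auto
    with e_pos[of K] show False by simp
  qed
  with \<open>0 \<le> L\<close> L(1) have "(\<lambda>n. \<bar>x (n + Suc N)\<bar>) \<longlonglongrightarrow> 0"
    by (simp add: y_def[abs_def])
  thus ?thesis by (rule LIMSEQ_offset)
qed

section \<open>Infinitely many crossings: step lengths\<close>

lemma eventually_steps_less_low_order: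
  assumes "\<alpha> \<le> 1" and freq: "\<exists>\<^sub>F n in sequentially. crossing n" and "R < B"
  shows "\<forall>\<^sub>F n in sequentially. d n < B"
proof -
  define M where "M n = max \<bar>x (Suc n)\<bar> (d n)" for n
  have M_nonneg: "0 \<le> M n" for n by (simp add: M_def)
  have d_le: "d (Suc n) \<le> \<phi> (M n)" for n
  proof -
    have "d (Suc n) \<le> \<rho> * \<mu> * \<bar>x (Suc n)\<bar> powr p * d n powr (1 - \<alpha>)"
      by (rule d_Suc_le)
    \<comment> \<open>For \<alpha> \<le> 1 both exponents are nonnegative, so distance and step
      length may both be replaced by their maximum.\<close>
    also have "\<dots> \<le> \<rho> * \<mu> * M n powr p * M n powr (1 - \<alpha>)"
      using \<rho>_pos \<mu>_pos p_pos \<open>\<alpha> \<le> 1\<close> d_pos[of n]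
      by (intro mult_mono mult_left_mono powr_mono2) (auto simp: M_def)
    also have "\<dots> = \<phi> (M n)"
      by (simp add: \<phi>_def mult.assoc powr_add[symmetric] add_diff_eq)
    finally show ?thesis .
  qed
  define S where "S n = max R (M n)" for n
  have d_le_S: "d (Suc n) \<le> S n" for n
    using d_le[of n] \<phi>_le_max[OF M_nonneg, of n] by (simp add: S_def)
  have "decseq S"
    unfolding decseq_Suc_iff
  proof
    fix n
    have "\<bar>x (Suc (Suc n))\<bar> \<le> max \<bar>x (Suc n)\<bar> (d (Suc n))"
      using crossing_le[of "Suc n"] not_crossing(1)[of n] d_pos[of "Suc n"]
      by (cases "crossing (Suc n)") auto
    thus "S (Suc n) \<le> S n" using d_le_S[of n] unfolding S_def M_def by linarith
  qed
  moreover have "\<exists>\<^sub>F n in sequentially. S (Suc n) \<le> max R (\<phi> (S n))"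
  proof -
    have "\<exists>\<^sub>F n in sequentially. crossing (Suc n)"
      using freq by (simp add: frequently_def eventually_sequentially_Suc[of "\<lambda>n. \<not> crossing n"])
    thus ?thesis
    proof (rule frequently_elim1)
      fix n assume "crossing (Suc n)"
      \<comment> \<open>At a crossing the step length dominates the landing distance, which drops
        out of the maximum.\<close>
      hence "M (Suc n) = d (Suc n)" using crossing_le[of "Suc n"] by (simp add: M_def)
      moreover have "\<phi> (M n) \<le> \<phi> (S n)"
        using M_nonneg by (intro \<phi>_mono) (auto simp: S_def)
      ultimately show "S (Suc n) \<le> max R (\<phi> (S n))"
        using d_le[of n] by (auto simp: S_def)
    qed
  qed
  ultimately have "S \<longlonglongrightarrow> R"
    using isCont_\<phi> \<phi>_less by (intro decseq_tendsto_lower_bound[of S R \<phi>]) (auto simp: S_def)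
  hence "\<forall>\<^sub>F n in sequentially. S n < B"
    using \<open>R < B\<close> by (rule order_tendstoD)
  thus ?thesis by eventually_elim (simp add: S_def M_def)
qed

text \<open>Now 1 - \<alpha> is negative and a short step worsens the bound on the next one, so
  merging distance and step length into one maximum fails; two consecutive steps are tracked
  instead.\<close>

lemma eventually_steps_less_high_order:
  assumes "1 < \<alpha>" and freq: "\<exists>\<^sub>F n in sequentially. crossing n" and "R < B"
  shows "\<forall>\<^sub>F n in sequentially. d n < B"
proof -
  \<comment> \<open>After a crossing the next step is at most \<phi> (S n). The step after that
    either follows another crossing, giving \<phi> again, or obeys the geometric mean bound; h takes
    the worse case.\<close>
  define h where "h y = max (\<phi> y) (\<phi> y powr (2 - \<alpha>) * y powr (\<alpha> - 1))" for y
  define S where "S n = max R (max (d n) (d (Suc n)))" for n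
  text \<open>Between crossings the gradient shrinks, so a step is at most the weighted geometric mean
    of its two predecessors.\<close>
  have geo: "d (Suc (Suc n)) \<le> d (Suc n) powr (2 - \<alpha>) * d n powr (\<alpha> - 1)"
    if "\<not> crossing (Suc n)" for n
  proof -
    have "d (Suc (Suc n)) \<le> \<rho> * \<bar>g (x (Suc n))\<bar> * d (Suc n) powr (1 - \<alpha>)"
      unfolding d_Suc[of "Suc n"] using not_crossing(2)[OF that] \<rho>_pos
      by (intro mult_right_mono mult_left_mono) auto
    \<comment> \<open>The recursion for the preceding step is solved for the gradient.\<close>
    also have "\<rho> * \<bar>g (x (Suc n))\<bar> = d (Suc n) * d n powr (\<alpha> - 1)"
      using d_pos[of n] by (simp add: d_Suc[of n] mult.assoc powr_add[symmetric])
    also have "d (Suc n) * d n powr (\<alpha> - 1) * d (Suc n) powr (1 - \<alpha>) =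
        d (Suc n) powr 1 * d (Suc n) powr (1 - \<alpha>) * d n powr (\<alpha> - 1)"
      using d_pos[of "Suc n"] by simp
    also have "\<dots> = d (Suc n) powr (2 - \<alpha>) * d n powr (\<alpha> - 1)"
      by (subst powr_add[symmetric]) simp
    finally show ?thesis .
  qed
  have "d (Suc (Suc n)) \<le> S n" for n
  proof (cases "crossing (Suc n)")
    case True
    thus ?thesis
      using d_Suc_le_\<phi>[of "Suc n"] \<phi>_le_max[of "d (Suc n)"] d_pos[of "Suc n"]
      by (auto simp: S_def)
  next
    case False
    have "d (Suc n) powr (2 - \<alpha>) * d n powr (1 - (2 - \<alpha>)) \<le> max (d (Suc n)) (d n)"
      using d_pos \<open>1 < \<alpha>\<close> \<alpha>_less by (intro weighted_geometric_mean_le_max) (auto simp: less_imp_le)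
    with geo[OF False] show ?thesis by (auto simp: S_def)
  qed
  hence "decseq S"
    by (auto simp: decseq_Suc_iff S_def)
  moreover have "\<exists>\<^sub>F n in sequentially. S (Suc n) \<le> max R (h (S n))"
    using freq
  proof (rule frequently_elim1)
    fix n assume c: "crossing n"
    have dS: "0 < d n" "d n \<le> S n" "0 < d (Suc n)" "d (Suc n) \<le> S n"
      using d_pos by (auto simp: S_def)
    have d1: "d (Suc n) \<le> \<phi> (S n)"
      using d_Suc_le_\<phi>[OF c] \<phi>_mono[of "d n" "S n"] dS by simp
    have "d (Suc (Suc n)) \<le> h (S n)"
    proof (cases "crossing (Suc n)")
      case True
      thus ?thesis
        using d_Suc_le_\<phi>[OF True] \<phi>_mono[of "d (Suc n)" "S n"] dS by (simp add: h_def)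
    next
      case False
      have "d (Suc n) powr (2 - \<alpha>) * d n powr (\<alpha> - 1) \<le> \<phi> (S n) powr (2 - \<alpha>) * S n powr (\<alpha> - 1)"
        using dS d1 \<open>1 < \<alpha>\<close> \<alpha>_less by (intro mult_mono powr_mono2) auto
      with geo[OF False] show ?thesis by (simp add: h_def)
    qed
    with d1 show "S (Suc n) \<le> max R (h (S n))"
      by (auto simp: S_def[of "Suc n"] h_def)
  qed
  moreover have "isCont h y" if "R < y" for y
  proof -
    have "\<phi> y \<noteq> 0" "y \<noteq> 0"
      using that R_pos \<rho>_pos \<mu>_pos by (auto simp: \<phi>_def)
    thus ?thesis
      unfolding h_def[abs_def] using isCont_\<phi>[OF that] by (intro continuous_intros) auto
  qed
  moreover have "h y < y" if "R < y" for y
  proof -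
    have "0 < y" using that R_pos by simp
    \<comment> \<open>Since \<alpha> < 2, \<phi> y carries positive weight and pulls the mean
      strictly below y.\<close>
    have "\<phi> y powr (2 - \<alpha>) * y powr (\<alpha> - 1) < y powr (2 - \<alpha>) * y powr (\<alpha> - 1)"
      using \<phi>_less[OF that] \<phi>_nonneg[of y] \<alpha>_less \<open>0 < y\<close>
      by (intro mult_strict_right_mono powr_less_mono2) auto
    also have "\<dots> = y" using \<open>0 < y\<close> by (simp add: powr_add[symmetric])
    finally show ?thesis using \<phi>_less[OF that] by (simp add: h_def)
  qed
  ultimately have "S \<longlonglongrightarrow> R"
    by (intro decseq_tendsto_lower_bound[of S R h]) (auto simp: S_def)
  hence "\<forall>\<^sub>F n in sequentially. S n < B"
    using \<open>R < B\<close> by (rule order_tendstoD)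
  thus ?thesis by eventually_elim (simp add: S_def)
qed

section \<open>From step lengths to distances\<close>

lemma eventually_abs_le:
  assumes "R < B"
  shows "\<forall>\<^sub>F n in sequentially. \<bar>x n\<bar> \<le> B"
proof (cases "\<exists>\<^sub>F n in sequentially. crossing n")
  case True
  hence "\<forall>\<^sub>F n in sequentially. d n < B"
    using eventually_steps_less_low_order eventually_steps_less_high_order assms
    by (cases "\<alpha> \<le> 1") auto
  then obtain N where N: "\<And>n. N \<le> n \<Longrightarrow> d n < B"
    by (auto simp: eventually_sequentially)
  obtain K where K: "N \<le> K" "crossing K"
    using True by (auto simp: frequently_sequentially)
  \<comment> \<open>The crossing at K lands within \<open>d K\<close> < B. Each later step either
    lands within its own length, also below B, or moves closer.\<close>
  have "\<bar>x n\<bar> \<le> B" if "Suc K \<le> n" for n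
    using that
  proof (induction n rule: dec_induct)
    case base
    show ?case using crossing_le[OF K(2)] N[OF K(1)] by simp
  next
    case (step n)
    then obtain n' where n': "n = Suc n'" by (cases n) auto
    show ?case
      using step K(1) crossing_le[of n] N[of n] not_crossing(1)[of n'] d_pos[of n]
      unfolding n' by (cases "crossing (Suc n')") auto
  qed
  thus ?thesis by (auto simp: eventually_sequentially)
next
  case False
  hence "(\<lambda>n. \<bar>x n\<bar>) \<longlonglongrightarrow> 0"
    by (intro tendsto_zero_if_finitely_many_crossings) (simp add: not_frequently)
  hence "\<forall>\<^sub>F n in sequentially. \<bar>x n\<bar> < B"
    using R_pos assms by (intro order_tendstoD(2)[of _ 0]) auto
  thus ?thesis by eventually_elim simp
qed

end

section \<open>Gradient of the convex function and the final reduction\<close>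

lemma convex_deriv_properties:
  fixes f :: "real \<Rightarrow> real"
  assumes diff: "\<And>z. f differentiable at z" and cvx: "convex_on UNIV f" and min: "unique_minimizer f s"
  shows "mono (deriv f)" and "deriv f z = 0 \<longleftrightarrow> z = s"
proof -
  have D: "(f has_field_derivative deriv f z) (at z)" for z
    using diff by (simp add: DERIV_deriv_iff_real_differentiable)
  have tangent: "deriv f c * (y - c) \<le> f y - f c" for c y
    using convex_on_imp_above_tangent[OF cvx, of c y "deriv f c"] D by simp
  show "mono (deriv f)"
  proof
    fix a b :: real assume "a \<le> b"
    \<comment> \<open>Adding the tangent inequalities at a and at b cancels the values of f.\<close>
    have "deriv f a * (b - a) \<le> deriv f b * (b - a)"
      using tangent[of a b] tangent[of b a] by (simp add: algebra_simps)
    thus "deriv f a \<le> deriv f b"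
      using \<open>a \<le> b\<close> by (cases "a = b") auto
  qed
  show "deriv f z = 0 \<longleftrightarrow> z = s"
  proof
    assume "deriv f z = 0"
    \<comment> \<open>A horizontal tangent makes z a global minimizer.\<close>
    thus "z = s" using tangent[of z] min by (auto simp: unique_minimizer_def)
  next
    assume "z = s"
    thus "deriv f z = 0"
      using DERIV_local_min[OF D, of 1 z] min by (auto simp: unique_minimizer_def)
  qed
qed

theorem theorem6:
  fixes f :: "real \<Rightarrow> real" and tstar p \<mu> \<alpha> \<rho> :: real and t :: "nat \<Rightarrow> real"
  assumes "f C1_differentiable_on UNIV"
    and "convex_on UNIV f"
    and "unique_minimizer f tstar"
    and "p > 0"
    and "\<mu> > 0"
    and "lipschitz_gradient p \<mu> f"
    and "0 < \<alpha>" and "\<alpha> < 2"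
    and "p < \<alpha>" and "\<alpha> < 1 + p"
    and "\<rho> > 0"
    and "frac_grad_seq f \<alpha> \<rho> t"
  shows "limsup (\<lambda>k. ereal \<bar>t k - tstar\<bar>) \<le> ereal ((\<rho> * \<mu>) powr (1 / (\<alpha> - p)))"
proof -
  define r where "r = (\<rho> * \<mu>) powr (1 / (\<alpha> - p))"
  have "0 < r" using assms by (simp add: r_def)
  define g where "g z = deriv f (z + tstar)" for z
  define x where "x n = t (Suc n) - tstar" for n
  have "f differentiable at z" for z
    using assms(1) by (simp add: C1_differentiable_on_eq)
  note deriv_f = convex_deriv_properties[OF this assms(2,3)]
  have g_mono: "mono g"
    using monoD[OF deriv_f(1)] by (auto simp: g_def intro!: monoI)
  have g_zero: "g z = 0 \<longleftrightarrow> z = 0" for z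
    by (simp add: g_def deriv_f(2))
  have g_bound: "\<bar>g z\<bar> \<le> \<mu> * \<bar>z\<bar> powr p" for z
    using assms(6)[unfolded lipschitz_gradient_def, rule_format, of "z + tstar" tstar] deriv_f(2)[of tstar]
    by (simp add: g_def)
  have rec: "x (Suc (Suc n)) = x (Suc n) - \<rho> * g (x (Suc n)) * rpow \<bar>x (Suc n) - x n\<bar> (1 - \<alpha>)" for n
    using assms(12)[unfolded frac_grad_seq_def, THEN conjunct2, THEN conjunct1, rule_format, of "Suc n"]
    by (simp add: x_def g_def)
  have rpow_eq: "rpow z (1 - \<alpha>) = z powr (1 - \<alpha>)" if "z \<noteq> 0" for z
    using that by (simp add: rpow_def)
  have x0: "x (Suc 0) \<noteq> x 0"
    using assms(12) by (auto simp: frac_grad_seq_def x_def numeral_2_eq_2)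
  have "\<forall>\<^sub>F n in sequentially. \<bar>x n\<bar> \<le> B" if "r < B" for B
  proof (cases "\<exists>n. x (Suc n) = x n")
    case False
    interpret fractional_descent g x p \<mu> \<alpha> \<rho>
      using assms g_mono g_zero g_bound rec False rpow_eq
      by unfold_locales auto
    show ?thesis using eventually_abs_le that by (simp add: R_def r_def)
  next
    case True
    text \<open>The first step of length zero starts at the minimizer.\<close>
    define n where "n = (LEAST n. x (Suc n) = x n)"
    have n: "x (Suc n) = x n" unfolding n_def using True by (rule LeastI_ex)
    with x0 obtain m where m: "n = Suc m" by (cases n) auto
    have "x (Suc m) \<noteq> x m"
      using not_less_Least[of m "\<lambda>n. x (Suc n) = x n"] m by (simp add: n_def)
    \<comment> \<open>The step before has nonzero length, so its power is a positive factor and only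
      the gradient can make the step vanish.\<close>
    hence "g (x n) = 0"
      using rec[of m] n assms(11) rpow_eq by (auto simp: m)
    hence "x n = 0" by (simp add: g_zero)
    \<comment> \<open>The vanishing gradient annihilates the product whatever value
      \<open>rpow\<close> takes at base 0, so the run stays at the minimizer.\<close>
    have "x k = 0 \<and> x (Suc k) = 0" if "n \<le> k" for k
      using that by (induction k rule: dec_induct) (use n \<open>x n = 0\<close> rec g_zero in auto)
    hence "\<bar>x k\<bar> \<le> B" if "n \<le> k" for k
      using \<open>0 < r\<close> \<open>r < B\<close> that by simp
    thus ?thesis by (rule eventually_sequentiallyI)
  qed
  hence "\<forall>\<^sub>F k in sequentially. \<bar>t k - tstar\<bar> \<le> B" if "r < B" for B
    using that eventually_sequentially_Suc[of "\<lambda>k. \<bar>t k - tstar\<bar> \<le> B"] by (simp add: x_def)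
  hence "limsup (\<lambda>k. ereal \<bar>t k - tstar\<bar>) \<le> ereal B" if "r < B" for B
    using that by (intro Limsup_bounded) auto
  hence "limsup (\<lambda>k. ereal \<bar>t k - tstar\<bar>) \<le> ereal r"
    by (simp add: ereal_le_epsilon2)
  thus ?thesis by (simp add: r_def)
qed

end
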